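(* Let $a<b$, $T>1$, let $p\ge 1$ be an integer, and let $f\in H^p(a,b)$. Then there exist constants $C>0$ and $C'>0$, independent of $N$, $K$, the partition and $\epsilon$, such that for all integers $N,K\ge 1$, every partition $a=a_0<a_1<\cdots<a_K=b$ with $I_k=[a_{k-1},a_k]$ and $s_k=\frac{T}{2\pi}(a_k-a_{k-1})$, and every $\epsilon>0$, $$\left|\int_a^b f(x)\,dx-\mathcal{Q}_{N,K}^{\epsilon}(f)\right|\le C(b-a)\,N^{-p}\max_{1\le k\le K}\left(s_k^{\,p-\frac12}\|f^{(p)}\|_{L^2(I_k)}\right)+C'\epsilon,$$ where $\mathcal{Q}_{N,K}^{\epsilon}(f)$ is the local Fourier extension quadrature associated with the partition.
   Context: Let $T>1$ and $\Lambda=[0,2\pi/T]$. For $|\ell|\le N$ let $\phi_\ell(t)=e^{i\ell t}$, and define the synthesis operator $\mathcal{F}_N:\mathbb{C}^{2N+1}\to L^2(\Lambda)$, $\mathcal{F}_N\mathbf{c}=\sum_{\ell=-N}^{N}c_\ell\phi_\ell$ for $\mathbf{c}=(c_\ell)_{|\ell|\le N}$; its range is $\Phi_N=\mathrm{span}\{\phi_\ell:|\ell|\le N\}$. Here $\mathbb{C}^{2N+1}$ carries the $\ell^2$ norm and $L^2(\Lambda)$ its usual inner product $\langle\cdot,\cdot\rangle$. Let $(\sigma_j,v_j,u_j)$ be a singular system of $\mathcal{F}_N$ (orthonormal $v_j\in\mathbb{C}^{2N+1}$, orthonormal $u_j\in L^2(\Lambda)$, $\mathcal{F}_Nv_j=\sigma_ju_j$,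 $\sigma_j>0$). Given a partition $a=a_0<\cdots<a_K=b$, set $I_k=[a_{k-1},a_k]$, $s_k=\frac{T}{2\pi}(a_k-a_{k-1})$, and $g_k(t)=f(a_{k-1}+s_kt)$ for $t\in\Lambda$, $k=1,\dots,K$. For a tolerance $\epsilon>0$ the truncated-SVD coefficient vector is $$\mathbf{c}_N^{\epsilon,k}=\sum_{\sigma_j>\epsilon}\frac{\langle g_k,u_j\rangle}{\sigma_j}v_j,$$ and $Q_N^\epsilon g_k=\mathcal{F}_N\mathbf{c}_N^{\epsilon,k}$. The local Fourier extension approximation of $f$ is defined piecewise by $$(P_{N,K}^{\epsilon}f)(x)=(Q_N^\epsilon g_k)\left(\frac{x-a_{k-1}}{s_k}\right),\qquad x\in I_k,\ k=1,\dots,K$$ (values at the finitely many common endpoints are irrelevant), and the quadrature is $\mathcal{Q}_{N,K}^{\epsilon}(f)=\int_a^b(P_{N,K}^{\epsilon}f)(x)\,dx$. $H^p(a,b)$ is the usual $L^2$-based Sobolev space. The constants may depend on $f,a,b,T,p$. *)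

theory Defs
  imports "HOL-Analysis.Analysis"
begin

section \<open>\<open>L\<^sup>2\<close> spaces and Sobolev spaces on subsets of the real line\<close>

text \<open>
  Elements of \<open>L\<^sup>2(S)\<close> are represented by functions on the whole line of which only the restriction
  to \<open>S\<close> matters; equality in \<open>L\<^sup>2(S)\<close> is equality almost everywhere on \<open>S\<close>.
\<close>

definition L2 :: "real set \<Rightarrow> (real \<Rightarrow> complex) set" where
  "L2 S = {f. f \<in> borel_measurable (lebesgue_on S) \<and>
              integrable (lebesgue_on S) (\<lambda>x. (cmod (f x))\<^sup>2)}"

definition L2_inner :: "real set \<Rightarrow> (real \<Rightarrow> complex) \<Rightarrow> (real \<Rightarrow> complex) \<Rightarrow> complex" where
  "L2_inner S f g = integral\<^sup>L (lebesgue_on S) (\<lambda>x. f x * cnj (g x))"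

definition L2_norm :: "real set \<Rightarrow> (real \<Rightarrow> complex) \<Rightarrow> real" where
  "L2_norm S f = sqrt (integral\<^sup>L (lebesgue_on S) (\<lambda>x. (cmod (f x))\<^sup>2))"

definition test_function :: "real \<Rightarrow> real \<Rightarrow> (real \<Rightarrow> real) \<Rightarrow> bool" where
  "test_function a b \<phi> \<longleftrightarrow>
     (\<forall>n x. ((deriv ^^ n) \<phi>) differentiable (at x)) \<and>
     (\<exists>S. compact S \<and> S \<subseteq> {a<..<b} \<and> (\<forall>x. x \<notin> S \<longrightarrow> \<phi> x = 0))"

definition has_weak_deriv ::
  "nat \<Rightarrow> real \<Rightarrow> real \<Rightarrow> (real \<Rightarrow> complex) \<Rightarrow> (real \<Rightarrow> complex) \<Rightarrow> bool" where
  "has_weak_deriv m a b f h \<longleftrightarrow>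
     (\<forall>\<phi>. test_function a b \<phi> \<longrightarrow>
        integral\<^sup>L (lebesgue_on {a<..<b}) (\<lambda>x. f x * of_real ((deriv ^^ m) \<phi> x)) =
        (- 1) ^ m * integral\<^sup>L (lebesgue_on {a<..<b}) (\<lambda>x. h x * of_real (\<phi> x)))"

definition sobolev :: "nat \<Rightarrow> real \<Rightarrow> real \<Rightarrow> (real \<Rightarrow> complex) set" where
  "sobolev p a b =
     {f \<in> L2 {a<..<b}. \<forall>m\<in>{1..p}. \<exists>h \<in> L2 {a<..<b}. has_weak_deriv m a b f h}"

text \<open>
  The weak derivative is unique only up to null sets, so this picks a representative; only its
  \<open>L\<^sup>2\<close> norms are used.
\<close>

definition weak_deriv :: "nat \<Rightarrow> real \<Rightarrow> real \<Rightarrow> (real \<Rightarrow> complex) \<Rightarrow> real \<Rightarrow> complex" where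
  "weak_deriv m a b f = (SOME h. h \<in> L2 {a<..<b} \<and> has_weak_deriv m a b f h)"


section \<open>Fourier extension by truncated singular value decomposition\<close>

text \<open>
  A vector \<open>(c\<^sub>l)\<close>, \<open>\<bar>l\<bar> \<le> N\<close>, of complex (2N+1)-space is represented by a function
  on the integers of which only the values on \<open>{-N..N}\<close> matter.
\<close>

definition freqs :: "nat \<Rightarrow> int set" where
  "freqs N = {- int N..int N}"

definition cvec_inner :: "nat \<Rightarrow> (int \<Rightarrow> complex) \<Rightarrow> (int \<Rightarrow> complex) \<Rightarrow> complex" where
  "cvec_inner N c d = (\<Sum>l\<in>freqs N. c l * cnj (d l))"

definition Lam :: "real \<Rightarrow> real set" where
  "Lam T = {0..2 * pi / T}"

definition synth :: "nat \<Rightarrow> (int \<Rightarrow> complex) \<Rightarrow> real \<Rightarrow> complex" where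
  "synth N c t = (\<Sum>l\<in>freqs N. c l * exp (\<i> * of_int l * of_real t))"

text \<open>
  The exponentials are linearly independent on \<open>Lam T\<close>, so the synthesis operator has rank
  \<open>2N+1\<close> and a singular system consists of exactly \<open>2N+1\<close> triples, indexed here by \<open>1, \<dots>, 2N+1\<close>.
\<close>

definition singular_system ::
  "real \<Rightarrow> nat \<Rightarrow> (nat \<Rightarrow> real) \<Rightarrow> (nat \<Rightarrow> int \<Rightarrow> complex) \<Rightarrow> (nat \<Rightarrow> real \<Rightarrow> complex) \<Rightarrow> bool" where
  "singular_system T N \<sigma> v u \<longleftrightarrow>
     (\<forall>j\<in>{1..2 * N + 1}. \<sigma> j > 0) \<and>
     (\<forall>i\<in>{1..2 * N + 1}. \<forall>j\<in>{1..2 * N + 1}.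
        cvec_inner N (v i) (v j) = (if i = j then 1 else 0)) \<and>
     (\<forall>j\<in>{1..2 * N + 1}. u j \<in> L2 (Lam T)) \<and>
     (\<forall>i\<in>{1..2 * N + 1}. \<forall>j\<in>{1..2 * N + 1}.
        L2_inner (Lam T) (u i) (u j) = (if i = j then 1 else 0)) \<and>
     (\<forall>j\<in>{1..2 * N + 1}.
        AE t in lebesgue_on (Lam T). synth N (v j) t = of_real (\<sigma> j) * u j t)"

definition tsvd_coeff ::
  "real \<Rightarrow> nat \<Rightarrow> (nat \<Rightarrow> real) \<Rightarrow> (nat \<Rightarrow> int \<Rightarrow> complex) \<Rightarrow> (nat \<Rightarrow> real \<Rightarrow> complex) \<Rightarrow>
   real \<Rightarrow> (real \<Rightarrow> complex) \<Rightarrow> int \<Rightarrow> complex" where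
  "tsvd_coeff T N \<sigma> v u \<epsilon> g l =
     (\<Sum>j | j \<in> {1..2 * N + 1} \<and> \<sigma> j > \<epsilon>.
        L2_inner (Lam T) g (u j) / of_real (\<sigma> j) * v j l)"

definition tsvd_approx ::
  "real \<Rightarrow> nat \<Rightarrow> (nat \<Rightarrow> real) \<Rightarrow> (nat \<Rightarrow> int \<Rightarrow> complex) \<Rightarrow> (nat \<Rightarrow> real \<Rightarrow> complex) \<Rightarrow>
   real \<Rightarrow> (real \<Rightarrow> complex) \<Rightarrow> real \<Rightarrow> complex" where
  "tsvd_approx T N \<sigma> v u \<epsilon> g = synth N (tsvd_coeff T N \<sigma> v u \<epsilon> g)"


section \<open>Local Fourier extension and the associated quadrature\<close>

definition is_partition :: "real \<Rightarrow> real \<Rightarrow> nat \<Rightarrow> (nat \<Rightarrow> real) \<Rightarrow> bool" where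
  "is_partition a b K x \<longleftrightarrow> x 0 = a \<and> x K = b \<and> (\<forall>k<K. x k < x (Suc k))"

definition subint :: "(nat \<Rightarrow> real) \<Rightarrow> nat \<Rightarrow> real set" where
  "subint x k = {x (k - 1)..x k}"

definition seg_scale :: "real \<Rightarrow> (nat \<Rightarrow> real) \<Rightarrow> nat \<Rightarrow> real" where
  "seg_scale T x k = T / (2 * pi) * (x k - x (k - 1))"

definition local_fun ::
  "real \<Rightarrow> (nat \<Rightarrow> real) \<Rightarrow> (real \<Rightarrow> complex) \<Rightarrow> nat \<Rightarrow> real \<Rightarrow> complex" where
  "local_fun T x f k t = f (x (k - 1) + seg_scale T x k * t)"

text \<open>
  At a common endpoint of two subintervals the value is taken from the left one. Outside
  \<open>[x 0, x K]\<close> the value is unspecified and never used.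
\<close>

definition local_ext ::
  "real \<Rightarrow> nat \<Rightarrow> (nat \<Rightarrow> real) \<Rightarrow> (nat \<Rightarrow> int \<Rightarrow> complex) \<Rightarrow> (nat \<Rightarrow> real \<Rightarrow> complex) \<Rightarrow>
   real \<Rightarrow> nat \<Rightarrow> (nat \<Rightarrow> real) \<Rightarrow> (real \<Rightarrow> complex) \<Rightarrow> real \<Rightarrow> complex" where
  "local_ext T N \<sigma> v u \<epsilon> K x f y =
     (let k = (LEAST k. k \<in> {1..K} \<and> y \<in> subint x k)
      in tsvd_approx T N \<sigma> v u \<epsilon> (local_fun T x f k) ((y - x (k - 1)) / seg_scale T x k))"

definition local_quad ::
  "real \<Rightarrow> nat \<Rightarrow> (nat \<Rightarrow> real) \<Rightarrow> (nat \<Rightarrow> int \<Rightarrow> complex) \<Rightarrow> (nat \<Rightarrow> real \<Rightarrow> complex) \<Rightarrow>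
   real \<Rightarrow> real \<Rightarrow> real \<Rightarrow> nat \<Rightarrow> (nat \<Rightarrow> real) \<Rightarrow> (real \<Rightarrow> complex) \<Rightarrow> complex" where
  "local_quad T N \<sigma> v u \<epsilon> a b K x f =
     integral\<^sup>L (lebesgue_on {a..b}) (local_ext T N \<sigma> v u \<epsilon> K x f)"

end

theory Submission
  imports Defs
begin

text \<open>
  The constant function \<open>1\<close> is the exponential of frequency \<open>0\<close>, hence lies in the range of the
  synthesis operator. Since the right singular vectors \<open>v j\<close> form an orthonormal basis of the
  coefficient space (\<open>orthonormal_complete\<close>), it has the expansion
  \<open>1 = (\<Sum>j. cnj (v j 0) * \<sigma> j * u j)\<close> on \<open>Lam T\<close> (\<open>one_expansion\<close>). So the integral of any square
  integrable \<open>g\<close> over \<open>Lam T\<close>, being the inner product of \<open>g\<close> with \<open>1\<close>, equals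
  \<open>(\<Sum>j. v j 0 * \<sigma> j * L2_inner (Lam T) g (u j))\<close>, and the integral of the truncated approximation is the
  same sum restricted to \<open>\<sigma> j > \<epsilon>\<close>. Their difference is the inner product of \<open>g\<close> with
  \<open>w = (\<Sum>j | \<sigma> j \<le> \<epsilon>. cnj (v j 0) * \<sigma> j * u j)\<close>, and \<open>w\<close> has norm at most \<open>\<epsilon>\<close> because
  \<open>\<sigma> j \<le> \<epsilon>\<close> in this sum and \<open>(\<Sum>j. (cmod (v j 0))\<^sup>2) = 1\<close>. The error of the integral is thus of
  order \<open>\<epsilon>\<close>, uniformly in \<open>N\<close> and without any smoothness of \<open>g\<close> (\<open>tsvd_integral_error\<close>): the
  approximation error is orthogonal to the constants up to the effect of the truncation.

  The affine maps from \<open>Lam T\<close> onto the subintervals scale these errors by the factors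
  \<open>seg_scale T x k\<close>, which add up to \<open>T / (2 * pi) * (b - a)\<close>, and the scaled squared norms of the
  local functions add up to the squared norm of \<open>f\<close>. The quadrature error is therefore at most
  a multiple of \<open>\<epsilon>\<close> depending only on \<open>f\<close>, \<open>T\<close> and \<open>b - a\<close> (\<open>quadrature_error\<close>), and the
  nonnegative term with the \<open>p\<close>-th derivative can be added for free.
\<close>

section \<open>Inner products of square integrable functions\<close>

lemma L2_mult_cnj_integrable:
  assumes "f \<in> L2 S" "g \<in> L2 S"
  shows "integrable (lebesgue_on S) (\<lambda>x. f x * cnj (g x))"
proof (rule Bochner_Integration.integrable_bound)
  show "integrable (lebesgue_on S) (\<lambda>x. (cmod (f x))\<^sup>2 + (cmod (g x))\<^sup>2)"
    using assms by (auto simp: L2_def)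
  have [measurable]: "f \<in> borel_measurable (lebesgue_on S)" "g \<in> borel_measurable (lebesgue_on S)"
    using assms by (auto simp: L2_def)
  have [measurable]: "cnj \<in> borel_measurable borel"
    by (intro borel_measurable_continuous_onI continuous_intros)
  show "(\<lambda>x. f x * cnj (g x)) \<in> borel_measurable (lebesgue_on S)"
    by measurable
  have "norm (f x * cnj (g x)) \<le> norm ((cmod (f x))\<^sup>2 + (cmod (g x))\<^sup>2)" for x
  proof -
    have "cmod (f x) * cmod (g x) \<le> (cmod (f x))\<^sup>2 + (cmod (g x))\<^sup>2"
      using sum_squares_bound[of "cmod (f x)" "cmod (g x)"]
        mult_nonneg_nonneg[of "cmod (f x)" "cmod (g x)", OF norm_ge_zero norm_ge_zero]
      by linarith
    then show ?thesis
      by (simp add: norm_mult)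
  qed
  then show "AE x in lebesgue_on S. norm (f x * cnj (g x)) \<le> norm ((cmod (f x))\<^sup>2 + (cmod (g x))\<^sup>2)"
    by simp
qed

lemma L2_inner_self:
  "L2_inner S f f = of_real (integral\<^sup>L (lebesgue_on S) (\<lambda>x. (cmod (f x))\<^sup>2))"
  unfolding L2_inner_def by (simp flip: complex_norm_square del: of_real_power)

lemma L2_cmult: "f \<in> L2 S \<Longrightarrow> (\<lambda>x. c * f x) \<in> L2 S"
  by (auto simp: L2_def norm_mult power_mult_distrib)

lemma L2_add:
  assumes "f \<in> L2 S" "g \<in> L2 S"
  shows "(\<lambda>x. f x + g x) \<in> L2 S"
proof -
  have [measurable]: "f \<in> borel_measurable (lebesgue_on S)" "g \<in> borel_measurable (lebesgue_on S)"
    using assms by (auto simp: L2_def)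
  have "integrable (lebesgue_on S) (\<lambda>x. (cmod (f x + g x))\<^sup>2)"
  proof (rule Bochner_Integration.integrable_bound)
    show "integrable (lebesgue_on S) (\<lambda>x. 2 * (cmod (f x))\<^sup>2 + 2 * (cmod (g x))\<^sup>2)"
      using assms by (auto simp: L2_def)
    have "(cmod (f x + g x))\<^sup>2 \<le> 2 * (cmod (f x))\<^sup>2 + 2 * (cmod (g x))\<^sup>2" for x
    proof -
      have "(cmod (f x + g x))\<^sup>2 \<le> (cmod (f x) + cmod (g x))\<^sup>2"
        by (intro power_mono norm_triangle_ineq) auto
      also have "\<dots> \<le> 2 * (cmod (f x))\<^sup>2 + 2 * (cmod (g x))\<^sup>2"
        using sum_squares_bound[of "cmod (f x)" "cmod (g x)"] by (simp add: power2_sum)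
      finally show ?thesis .
    qed
    then show "AE x in lebesgue_on S.
        norm ((cmod (f x + g x))\<^sup>2) \<le> norm (2 * (cmod (f x))\<^sup>2 + 2 * (cmod (g x))\<^sup>2)"
      by simp
  qed measurable
  then show ?thesis
    by (simp add: L2_def)
qed

lemma L2_sum:
  assumes "\<And>i. i \<in> I \<Longrightarrow> f i \<in> L2 S"
  shows "(\<lambda>x. \<Sum>i\<in>I. f i x) \<in> L2 S"
  using assms
proof (induction I rule: infinite_finite_induct)
  case (insert i I)
  then show ?case by (simp add: L2_add)
qed (auto simp: L2_def)

lemma L2_inner_sum_right:
  assumes "g \<in> L2 S" "\<And>j. j \<in> J \<Longrightarrow> u j \<in> L2 S"
  shows "L2_inner S g (\<lambda>t. \<Sum>j\<in>J. c j * u j t) = (\<Sum>j\<in>J. cnj (c j) * L2_inner S g (u j))"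
proof -
  have "L2_inner S g (\<lambda>t. \<Sum>j\<in>J. c j * u j t)
        = integral\<^sup>L (lebesgue_on S) (\<lambda>t. \<Sum>j\<in>J. cnj (c j) * (g t * cnj (u j t)))"
    by (simp add: L2_inner_def sum_distrib_left algebra_simps)
  also have "\<dots> = (\<Sum>j\<in>J. cnj (c j) * L2_inner S g (u j))"
    using L2_mult_cnj_integrable[OF assms] by (simp add: L2_inner_def)
  finally show ?thesis .
qed

text \<open>
  This weak form of the Cauchy-Schwarz inequality is linear in the squared norms, so it can be summed
  over the pieces of a partition directly.
\<close>

lemma L2_inner_Young:
  assumes "f \<in> L2 S" "g \<in> L2 S" "\<epsilon> > 0"
  shows "cmod (L2_inner S f g) \<le>
    \<epsilon> / 2 * integral\<^sup>L (lebesgue_on S) (\<lambda>x. (cmod (f x))\<^sup>2)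
    + integral\<^sup>L (lebesgue_on S) (\<lambda>x. (cmod (g x))\<^sup>2) / (2 * \<epsilon>)"
proof -
  have "cmod (L2_inner S f g) \<le> integral\<^sup>L (lebesgue_on S) (\<lambda>x. norm (f x * cnj (g x)))"
    unfolding L2_inner_def by (rule integral_norm_bound)
  also have "\<dots> \<le> integral\<^sup>L (lebesgue_on S)
      (\<lambda>x. \<epsilon> / 2 * (cmod (f x))\<^sup>2 + (cmod (g x))\<^sup>2 / (2 * \<epsilon>))"
  proof (rule integral_mono)
    show "integrable (lebesgue_on S) (\<lambda>x. norm (f x * cnj (g x)))"
      using L2_mult_cnj_integrable[OF assms(1,2)] by (rule integrable_norm)
    show "integrable (lebesgue_on S) (\<lambda>x. \<epsilon> / 2 * (cmod (f x))\<^sup>2 + (cmod (g x))\<^sup>2 / (2 * \<epsilon>))"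
      using assms by (auto simp: L2_def)
    show "norm (f x * cnj (g x)) \<le> \<epsilon> / 2 * (cmod (f x))\<^sup>2 + (cmod (g x))\<^sup>2 / (2 * \<epsilon>)" for x
    proof -
      have "0 \<le> (\<epsilon> * cmod (f x) - cmod (g x))\<^sup>2 / (2 * \<epsilon>)"
        using assms(3) by simp
      also have "\<dots> = \<epsilon> / 2 * (cmod (f x))\<^sup>2 + (cmod (g x))\<^sup>2 / (2 * \<epsilon>) - cmod (f x) * cmod (g x)"
        using assms(3) by (simp add: power2_eq_square field_simps)
      finally show ?thesis
        by (simp add: norm_mult)
    qed
  qed
  also have "\<dots> = \<epsilon> / 2 * integral\<^sup>L (lebesgue_on S) (\<lambda>x. (cmod (f x))\<^sup>2)
      + integral\<^sup>L (lebesgue_on S) (\<lambda>x. (cmod (g x))\<^sup>2) / (2 * \<epsilon>)"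
    using assms by (simp add: L2_def)
  finally show ?thesis .
qed

lemma L2_const: "(\<lambda>x. c) \<in> L2 {a..b}"
  by (simp add: L2_def)

lemma L2_imp_integrable:
  assumes "f \<in> L2 {a..b}"
  shows "integrable (lebesgue_on {a..b}) f"
  using L2_mult_cnj_integrable[OF assms L2_const[of 1]] by simp

section \<open>Integrals over intervals and partitions\<close>

lemma AE_lebesgue_finite:
  fixes F :: "real set"
  assumes "finite F" "\<And>x. x \<notin> F \<Longrightarrow> P x"
  shows "AE x in lebesgue. P x"
  by (rule AE_I'[of F]) (use assms in \<open>auto simp: null_sets_completionI finite_imp_null_set_lborel\<close>)

lemma has_bochner_integral_spike_finite:
  fixes f g :: "real \<Rightarrow> 'a::euclidean_space"
  assumes "has_bochner_integral (lebesgue_on S) f i" "S \<in> sets lebesgue"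
    and "finite F" "\<And>x. x \<in> S - F \<Longrightarrow> f x = g x"
  shows "has_bochner_integral (lebesgue_on S) g i"
proof -
  have f: "has_bochner_integral lebesgue (\<lambda>x. indicator S x *\<^sub>R f x) i"
    using assms(1,2) by (simp add: has_bochner_integral_restrict_space)
  have AE: "AE x in lebesgue. indicator S x *\<^sub>R f x = indicator S x *\<^sub>R g x"
    by (rule AE_lebesgue_finite[OF assms(3)]) (use assms(4) in \<open>auto simp: indicator_def\<close>)
  have "has_bochner_integral lebesgue (\<lambda>x. indicator S x *\<^sub>R g x) i"
    by (rule has_bochner_integralI_AE[OF f borel_measurable_AE[OF _ AE] AE])
      (use f in \<open>auto simp: has_bochner_integral_iff\<close>)
  then show ?thesis
    using assms(2) by (simp add: has_bochner_integral_restrict_space)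
qed

lemma L2_closed_interval:
  assumes "f \<in> L2 {a<..<b}"
  shows "f \<in> L2 {a..b}"
proof -
  have "(\<lambda>x. if x \<in> {a<..<b} then f x else 0) \<in> borel_measurable lebesgue"
    using assms by (subst borel_measurable_if) (auto simp: L2_def)
  moreover have "AE x in lebesgue. (if x \<in> {a<..<b} then f x else 0) = (if x \<in> {a..b} then f x else 0)"
    by (rule AE_lebesgue_finite[of "{a, b}"]) auto
  ultimately have meas: "f \<in> borel_measurable (lebesgue_on {a..b})"
    by (rule borel_measurable_if_D[OF borel_measurable_AE])
  define I where "I = integral\<^sup>L (lebesgue_on {a<..<b}) (\<lambda>x. (cmod (f x))\<^sup>2)"
  have "has_bochner_integral (lebesgue_on {a<..<b}) (\<lambda>x. (cmod (f x))\<^sup>2) I"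
    using assms by (simp add: L2_def has_bochner_integral_iff I_def)
  then have "has_bochner_integral lebesgue (\<lambda>x. indicator {a<..<b} x *\<^sub>R (cmod (f x))\<^sup>2) I"
    by (simp add: has_bochner_integral_restrict_space)
  then have "has_bochner_integral lebesgue (\<lambda>x. indicator {a..b} x *\<^sub>R (cmod (f x))\<^sup>2) I"
    by (rule has_bochner_integral_spike_finite[where S = UNIV and F = "{a, b}",
          unfolded lebesgue_on_UNIV_eq]) (auto simp: indicator_def)
  then have "integrable (lebesgue_on {a..b}) (\<lambda>x. (cmod (f x))\<^sup>2)"
    by (simp add: integrable_restrict_space has_bochner_integral_iff)
  with meas show ?thesis
    by (simp add: L2_def)
qed

lemma L2_subset:
  assumes "f \<in> L2 B" "A \<subseteq> B" "A \<in> sets lebesgue" "B \<in> sets lebesgue"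
  shows "f \<in> L2 A"
proof -
  have "f \<in> borel_measurable (lebesgue_on A)"
    using assms by (auto simp: L2_def intro: measurable_restrict_mono)
  moreover have "integrable lebesgue (\<lambda>x. if x \<in> B then (cmod (f x))\<^sup>2 else 0)"
    using assms by (simp add: L2_def Lebesgue_Measure.integrable_restrict_UNIV)
  then have "integrable lebesgue (\<lambda>x. indicator A x *\<^sub>R (if x \<in> B then (cmod (f x))\<^sup>2 else 0))"
    using assms by (intro integrable_mult_indicator) auto
  moreover have "(\<lambda>x. indicator A x *\<^sub>R (if x \<in> B then (cmod (f x))\<^sup>2 else 0))
      = (\<lambda>x. if x \<in> A then (cmod (f x))\<^sup>2 else 0)"
    using assms(2) by (auto simp: fun_eq_iff indicator_def)
  ultimately show ?thesis
    using assms(3) by (simp add: L2_def Lebesgue_Measure.integrable_restrict_UNIV)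
qed

lemma has_bochner_integral_affine_interval:
  fixes f :: "real \<Rightarrow> 'a::euclidean_space"
  assumes "c > 0"
  shows "has_bochner_integral (lebesgue_on {t + c * r..t + c * s}) f (c *\<^sub>R i) \<longleftrightarrow>
         has_bochner_integral (lebesgue_on {r..s}) (\<lambda>x. f (t + c * x)) i"
proof -
  have "has_bochner_integral (lebesgue_on {t + c * r..t + c * s}) f (c *\<^sub>R i) \<longleftrightarrow>
        has_bochner_integral lebesgue (\<lambda>x. indicator {t + c * r..t + c * s} x *\<^sub>R f x) (c *\<^sub>R i)"
    by (simp add: has_bochner_integral_restrict_space)
  also have "\<dots> \<longleftrightarrow> has_bochner_integral lebesgue
      (\<lambda>x. indicator {t + c * r..t + c * s} (t + c * x) *\<^sub>R f (t + c * x)) i"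
    using assms has_bochner_integral_lebesgue_real_affine_iff
      [of c "\<lambda>x. indicator {t + c * r..t + c * s} x *\<^sub>R f x" "c *\<^sub>R i" t]
    by simp
  also have "(\<lambda>x. indicator {t + c * r..t + c * s} (t + c * x) *\<^sub>R f (t + c * x))
      = (\<lambda>x. indicator {r..s} x *\<^sub>R f (t + c * x))"
    using assms by (auto simp: fun_eq_iff indicator_def)
  also have "has_bochner_integral lebesgue (\<lambda>x. indicator {r..s} x *\<^sub>R f (t + c * x)) i \<longleftrightarrow>
      has_bochner_integral (lebesgue_on {r..s}) (\<lambda>x. f (t + c * x)) i"
    by (simp add: has_bochner_integral_restrict_space)
  finally show ?thesis .
qed

lemma L2_affine:
  assumes "f \<in> L2 {t + c * r..t + c * s}" "c > 0"
  shows "(\<lambda>x. f (t + c * x)) \<in> L2 {r..s}"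
proof -
  let ?I = "{t + c * r..t + c * s}"
  have [measurable]: "(\<lambda>x. if x \<in> ?I then f x else 0) \<in> borel_measurable lebesgue"
    using assms by (subst borel_measurable_if) (auto simp: L2_def)
  have [measurable]: "(\<lambda>x. t + c * x) \<in> lebesgue \<rightarrow>\<^sub>M lebesgue"
    using lebesgue_affine_measurable[of "\<lambda>_. c" t] assms(2) by simp
  have "(\<lambda>x. if t + c * x \<in> ?I then f (t + c * x) else 0) \<in> borel_measurable lebesgue"
    using measurable_compose[OF \<open>(\<lambda>x. t + c * x) \<in> lebesgue \<rightarrow>\<^sub>M lebesgue\<close>
        \<open>(\<lambda>x. if x \<in> ?I then f x else 0) \<in> borel_measurable lebesgue\<close>] .
  moreover have "(\<lambda>x. if t + c * x \<in> ?I then f (t + c * x) else 0)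
      = (\<lambda>x. if x \<in> {r..s} then f (t + c * x) else 0)"
    using assms(2) by (auto simp: fun_eq_iff)
  ultimately have "(\<lambda>x. f (t + c * x)) \<in> borel_measurable (lebesgue_on {r..s})"
    by (simp add: borel_measurable_if_D)
  moreover have "has_bochner_integral (lebesgue_on ?I) (\<lambda>x. (cmod (f x))\<^sup>2)
      (c *\<^sub>R (integral\<^sup>L (lebesgue_on ?I) (\<lambda>x. (cmod (f x))\<^sup>2) / c))"
    using assms by (simp add: L2_def has_bochner_integral_iff)
  then have "integrable (lebesgue_on {r..s}) (\<lambda>x. (cmod (f (t + c * x)))\<^sup>2)"
    unfolding has_bochner_integral_affine_interval[OF assms(2)] by (simp add: has_bochner_integral_iff)
  ultimately show ?thesis
    by (simp add: L2_def)
qed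

lemma chain_mono:
  fixes x :: "nat \<Rightarrow> 'a::preorder"
  assumes "\<And>k. k < K \<Longrightarrow> x k \<le> x (Suc k)" "i \<le> j" "j \<le> K"
  shows "x i \<le> x j"
  using assms(2,3)
proof (induction j rule: dec_induct)
  case (step n)
  then have "x i \<le> x n" "x n \<le> x (Suc n)"
    using assms(1) by auto
  then show ?case
    by (rule order_trans)
qed simp

lemma has_bochner_integral_partition:
  fixes h :: "real \<Rightarrow> 'a::euclidean_space"
  assumes "\<And>k. k < K \<Longrightarrow> x k \<le> x (Suc k)"
    and "\<And>k. k < K \<Longrightarrow> has_bochner_integral (lebesgue_on {x k..x (Suc k)}) h (i k)"
  shows "has_bochner_integral (lebesgue_on {x 0..x K}) h (\<Sum>k<K. i k)"
  using assms
proof (induction K)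
  case 0
  have "has_bochner_integral (lebesgue_on {x 0}) h 0"
    by (rule has_bochner_integral_spike_finite[where f = "\<lambda>_. 0" and F = "{x 0}"]) auto
  then show ?case
    by simp
next
  case (Suc K)
  have "x 0 \<le> x K"
    by (rule chain_mono[of K]) (simp_all add: Suc.prems(1))
  show ?case
    unfolding sum.lessThan_Suc
  proof (rule has_bochner_integral_combine)
    show "x 0 \<le> x K" by fact
    show "x K \<le> x (Suc K)"
      by (rule Suc.prems(1)) simp
    show "has_bochner_integral (lebesgue_on {x 0..x K}) h (\<Sum>k<K. i k)"
      by (rule Suc.IH) (simp_all add: Suc.prems)
    show "has_bochner_integral (lebesgue_on {x K..x (Suc K)}) h (i K)"
      by (rule Suc.prems(2)) simp
  qed
qed

section \<open>Singular systems of the synthesis operator\<close>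

text \<open>
  An orthonormal system of \<open>2 * N + 1\<close> vectors is complete. The residuals \<open>r l\<close> of the projections
  of the unit vectors \<open>e l\<close> onto its span have squared norms \<open>1 - P l l\<close>, where \<open>P\<close> is the matrix
  of the projection; these add up to the dimension minus the trace of \<open>P\<close>, which is \<open>0\<close>. Hence
  every residual vanishes.
\<close>

lemma orthonormal_complete:
  assumes "\<And>i j. i \<in> {1..2 * N + 1} \<Longrightarrow> j \<in> {1..2 * N + 1} \<Longrightarrow>
             cvec_inner N (v i) (v j) = (if i = j then 1 else 0)"
    and "l \<in> freqs N" "m \<in> freqs N"
  shows "(\<Sum>j\<in>{1..2 * N + 1}. cnj (v j l) * v j m) = (if l = m then 1 else 0)"
proof -
  define J where "J = {1..2 * N + 1}"
  have fin: "finite (freqs N)" "finite J" and card: "card (freqs N) = card J"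
    by (auto simp: freqs_def J_def)
  define e :: "int \<Rightarrow> int \<Rightarrow> complex" where "e l m = (if l = m then 1 else 0)" for l m
  define P where "P l m = (\<Sum>j\<in>J. cnj (v j l) * v j m)" for l m
  define r where "r l m = e l m - P l m" for l m
  have on: "(\<Sum>m\<in>freqs N. v i m * cnj (v j m)) = (if i = j then 1 else 0)"
    if "i \<in> J" "j \<in> J" for i j
    using assms(1)[of i j] that by (simp add: J_def cvec_inner_def)
  have norm_r: "(\<Sum>m\<in>freqs N. r l m * cnj (r l m)) = 1 - P l l" if l: "l \<in> freqs N" for l
  proof -
    have PP: "(\<Sum>m\<in>freqs N. P l m * cnj (P l m)) = P l l"
    proof -
      have "(\<Sum>m\<in>freqs N. P l m * cnj (P l m)) =
         (\<Sum>m\<in>freqs N. \<Sum>i\<in>J. \<Sum>j\<in>J. cnj (v i l) * v j l * (v i m * cnj (v j m)))"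
        by (simp add: P_def sum_product mult_ac)
      also have "\<dots> = (\<Sum>i\<in>J. \<Sum>m\<in>freqs N. \<Sum>j\<in>J. cnj (v i l) * v j l * (v i m * cnj (v j m)))"
        by (rule sum.swap)
      also have "\<dots> = (\<Sum>i\<in>J. \<Sum>j\<in>J. \<Sum>m\<in>freqs N. cnj (v i l) * v j l * (v i m * cnj (v j m)))"
        by (intro sum.cong refl sum.swap)
      also have "\<dots> = (\<Sum>i\<in>J. \<Sum>j\<in>J. cnj (v i l) * v j l * (if i = j then 1 else 0))"
        by (simp add: sum_distrib_left[symmetric] on)
      also have "\<dots> = (\<Sum>i\<in>J. cnj (v i l) * v i l)"
        using fin(2) by (intro sum.cong refl) (simp add: if_distrib[where f="\<lambda>z. _ * z"] cong: if_cong)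
      finally show ?thesis by (simp add: P_def)
    qed
    have eP: "(\<Sum>m\<in>freqs N. e l m * z m) = z l" for z
      using l fin(1) by (simp add: e_def if_distrib[where f="\<lambda>w. w * _"] cong: if_cong)
    have "(\<Sum>m\<in>freqs N. r l m * cnj (r l m)) =
        (\<Sum>m\<in>freqs N. e l m * cnj (e l m)) - (\<Sum>m\<in>freqs N. e l m * cnj (P l m))
        - (\<Sum>m\<in>freqs N. cnj (e l m * cnj (P l m))) + (\<Sum>m\<in>freqs N. P l m * cnj (P l m))"
      by (simp add: r_def algebra_simps sum.distrib sum_subtractf)
    also have "\<dots> = 1 - P l l"
      unfolding PP cnj_sum[symmetric] eP by (simp add: e_def P_def mult.commute)
    finally show ?thesis .
  qed
  have "(\<Sum>l\<in>freqs N. P l l) = (\<Sum>j\<in>J. \<Sum>l\<in>freqs N. v j l * cnj (v j l))"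
    unfolding P_def by (subst sum.swap) (simp add: mult.commute)
  also have "\<dots> = of_nat (card J)"
    by (simp add: on)
  finally have trace: "(\<Sum>l\<in>freqs N. P l l) = of_nat (card J)" .
  have "of_real (\<Sum>l\<in>freqs N. \<Sum>m\<in>freqs N. (cmod (r l m))\<^sup>2)
      = (\<Sum>l\<in>freqs N. \<Sum>m\<in>freqs N. r l m * cnj (r l m))"
    by (simp flip: complex_norm_square)
  also have "\<dots> = (\<Sum>l\<in>freqs N. 1 - P l l)"
    by (intro sum.cong refl norm_r)
  also have "\<dots> = 0"
    using trace card by (simp add: sum_subtractf)
  finally have "(\<Sum>l\<in>freqs N. \<Sum>m\<in>freqs N. (cmod (r l m))\<^sup>2) = 0"
    by (simp only: of_real_eq_0_iff)
  then have "r l m = 0"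
    using assms(2,3) fin by (simp add: sum_nonneg_eq_0_iff sum_nonneg)
  then show ?thesis
    by (simp add: r_def e_def P_def J_def)
qed

lemma continuous_on_synth: "continuous_on S (synth N c)"
  unfolding synth_def[abs_def] by (intro continuous_intros)

lemma synth_sum: "synth N (\<lambda>l. \<Sum>j\<in>J. d j * v j l) t = (\<Sum>j\<in>J. d j * synth N (v j) t)"
proof -
  have "synth N (\<lambda>l. \<Sum>j\<in>J. d j * v j l) t =
      (\<Sum>l\<in>freqs N. \<Sum>j\<in>J. d j * (v j l * exp (\<i> * of_int l * of_real t)))"
    by (simp add: synth_def sum_distrib_right mult.assoc)
  also have "\<dots> = (\<Sum>j\<in>J. \<Sum>l\<in>freqs N. d j * (v j l * exp (\<i> * of_int l * of_real t)))"
    by (rule sum.swap)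
  also have "\<dots> = (\<Sum>j\<in>J. d j * synth N (v j) t)"
    by (simp add: synth_def sum_distrib_left)
  finally show ?thesis .
qed

lemma one_expansion:
  assumes "singular_system T N \<sigma> v u"
  shows "AE t in lebesgue_on (Lam T). (\<Sum>j\<in>{1..2 * N + 1}. cnj (v j 0) * of_real (\<sigma> j) * u j t) = 1"
proof -
  have "AE t in lebesgue_on (Lam T). \<forall>j\<in>{1..2 * N + 1}. synth N (v j) t = of_real (\<sigma> j) * u j t"
    using assms by (intro AE_finite_allI) (auto simp: singular_system_def)
  then show ?thesis
  proof eventually_elim
    case (elim t)
    have "(\<Sum>j\<in>{1..2 * N + 1}. cnj (v j 0) * of_real (\<sigma> j) * u j t)
        = synth N (\<lambda>l. \<Sum>j\<in>{1..2 * N + 1}. cnj (v j 0) * v j l) t"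
      unfolding synth_sum using elim by (intro sum.cong refl) simp
    \<comment> \<open>By completeness the coefficient vector is the unit vector of frequency \<open>0\<close>.\<close>
    also have "\<dots> = (\<Sum>l\<in>freqs N. (if 0 = l then 1 else 0) * exp (\<i> * of_int l * of_real t))"
      unfolding synth_def
      using assms by (intro sum.cong refl arg_cong2[of _ _ _ _ "(*)"] orthonormal_complete)
        (auto simp: singular_system_def freqs_def)
    also have "\<dots> = 1"
      by (simp add: freqs_def if_distrib[where f="\<lambda>w. w * _"] cong: if_cong)
    finally show ?case .
  qed
qed

lemma integral_Lam_expansion:
  assumes "singular_system T N \<sigma> v u" "g \<in> L2 (Lam T)"
  shows "integral\<^sup>L (lebesgue_on (Lam T)) g =
    (\<Sum>j\<in>{1..2 * N + 1}. v j 0 * of_real (\<sigma> j) * L2_inner (Lam T) g (u j))"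
proof -
  define w where "w t = (\<Sum>j\<in>{1..2 * N + 1}. cnj (v j 0) * of_real (\<sigma> j) * u j t)" for t
  have u: "u j \<in> L2 (Lam T)" if "j \<in> {1..2 * N + 1}" for j
    using assms(1) that by (simp add: singular_system_def)
  have w: "w \<in> L2 (Lam T)"
    unfolding w_def[abs_def] by (intro L2_sum L2_cmult u)
  have "integral\<^sup>L (lebesgue_on (Lam T)) g = L2_inner (Lam T) g w"
    unfolding L2_inner_def
  proof (rule integral_cong_AE)
    show "g \<in> borel_measurable (lebesgue_on (Lam T))"
      using assms(2) by (simp add: L2_def)
    show "(\<lambda>t. g t * cnj (w t)) \<in> borel_measurable (lebesgue_on (Lam T))"
      using L2_mult_cnj_integrable[OF assms(2) w] by (rule borel_measurable_integrable)
    show "AE t in lebesgue_on (Lam T). g t = g t * cnj (w t)"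
      using one_expansion[OF assms(1)] by eventually_elim (simp add: w_def)
  qed
  also have "\<dots> = (\<Sum>j\<in>{1..2 * N + 1}. cnj (cnj (v j 0) * of_real (\<sigma> j)) * L2_inner (Lam T) g (u j))"
    unfolding w_def[abs_def] by (intro L2_inner_sum_right assms(2) u)
  finally show ?thesis by simp
qed

section \<open>Truncated approximation on the reference interval\<close>

lemma tsvd_approx_AE:
  assumes "singular_system T N \<sigma> v u"
  shows "AE t in lebesgue_on (Lam T). tsvd_approx T N \<sigma> v u \<epsilon> g t =
    (\<Sum>j | j \<in> {1..2 * N + 1} \<and> \<sigma> j > \<epsilon>. L2_inner (Lam T) g (u j) * u j t)"
proof -
  have "AE t in lebesgue_on (Lam T). \<forall>j\<in>{1..2 * N + 1}. synth N (v j) t = of_real (\<sigma> j) * u j t"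
    using assms by (intro AE_finite_allI) (auto simp: singular_system_def)
  then show ?thesis
  proof eventually_elim
    case (elim t)
    have pos: "\<sigma> j > 0" if "j \<in> {1..2 * N + 1}" for j
      using assms that by (simp add: singular_system_def)
    have "tsvd_approx T N \<sigma> v u \<epsilon> g t = (\<Sum>j | j \<in> {1..2 * N + 1} \<and> \<sigma> j > \<epsilon>.
        L2_inner (Lam T) g (u j) / of_real (\<sigma> j) * synth N (v j) t)"
      unfolding tsvd_approx_def tsvd_coeff_def[abs_def] by (rule synth_sum)
    also have "\<dots> = (\<Sum>j | j \<in> {1..2 * N + 1} \<and> \<sigma> j > \<epsilon>. L2_inner (Lam T) g (u j) * u j t)"
      using elim pos by (intro sum.cong refl) (auto simp: less_imp_neq[symmetric])
    finally show ?case .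
  qed
qed

lemma integral_tsvd_approx:
  assumes "singular_system T N \<sigma> v u" "g \<in> L2 (Lam T)"
  shows "integral\<^sup>L (lebesgue_on (Lam T)) (tsvd_approx T N \<sigma> v u \<epsilon> g) =
    (\<Sum>j | j \<in> {1..2 * N + 1} \<and> \<sigma> j > \<epsilon>. v j 0 * of_real (\<sigma> j) * L2_inner (Lam T) g (u j))"
proof -
  let ?J = "{1..2 * N + 1}" and ?H = "{j. j \<in> {1..2 * N + 1} \<and> \<sigma> j > \<epsilon>}"
  have u: "u j \<in> L2 (Lam T)" if "j \<in> ?J" for j
    using assms(1) that by (simp add: singular_system_def)
  have int_u: "integrable (lebesgue_on (Lam T)) (u j)" if "j \<in> ?J" for j
    using u[OF that] by (simp add: Lam_def L2_imp_integrable)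
  have "integral\<^sup>L (lebesgue_on (Lam T)) (u i) = v i 0 * of_real (\<sigma> i)" if i: "i \<in> ?J" for i
  proof -
    have "integral\<^sup>L (lebesgue_on (Lam T)) (u i) =
        (\<Sum>j\<in>?J. v j 0 * of_real (\<sigma> j) * L2_inner (Lam T) (u i) (u j))"
      by (rule integral_Lam_expansion[OF assms(1) u[OF i]])
    also have "\<dots> = (\<Sum>j\<in>?J. if i = j then v j 0 * of_real (\<sigma> j) else 0)"
      using assms(1) i by (intro sum.cong refl) (simp add: singular_system_def)
    finally show ?thesis
      using i by simp
  qed
  note int_u_eq = this
  have "integral\<^sup>L (lebesgue_on (Lam T)) (tsvd_approx T N \<sigma> v u \<epsilon> g) =
     integral\<^sup>L (lebesgue_on (Lam T)) (\<lambda>t. \<Sum>j\<in>?H. L2_inner (Lam T) g (u j) * u j t)"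
  proof (rule integral_cong_AE)
    show "tsvd_approx T N \<sigma> v u \<epsilon> g \<in> borel_measurable (lebesgue_on (Lam T))"
      using continuous_imp_integrable_real[OF continuous_on_synth]
      by (auto simp: tsvd_approx_def Lam_def intro!: borel_measurable_integrable)
    show "(\<lambda>t. \<Sum>j\<in>?H. L2_inner (Lam T) g (u j) * u j t) \<in> borel_measurable (lebesgue_on (Lam T))"
      using int_u by (intro borel_measurable_integrable Bochner_Integration.integrable_sum
          integrable_mult_right) auto
  qed (rule tsvd_approx_AE[OF assms(1)])
  also have "\<dots> = (\<Sum>j\<in>?H. L2_inner (Lam T) g (u j) * integral\<^sup>L (lebesgue_on (Lam T)) (u j))"
    using int_u by (subst Bochner_Integration.integral_sum) auto
  also have "\<dots> = (\<Sum>j\<in>?H. v j 0 * of_real (\<sigma> j) * L2_inner (Lam T) g (u j))"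
    by (intro sum.cong refl) (simp add: int_u_eq)
  finally show ?thesis .
qed

lemma tsvd_integral_error:
  assumes "singular_system T N \<sigma> v u" "g \<in> L2 (Lam T)" "\<epsilon> > 0"
  shows "cmod (integral\<^sup>L (lebesgue_on (Lam T)) g
               - integral\<^sup>L (lebesgue_on (Lam T)) (tsvd_approx T N \<sigma> v u \<epsilon> g))
    \<le> \<epsilon> / 2 * (integral\<^sup>L (lebesgue_on (Lam T)) (\<lambda>t. (cmod (g t))\<^sup>2) + 1)"
proof -
  define J where "J = {1..2 * N + 1}"
  define H where "H = {j. j \<in> J \<and> \<sigma> j > \<epsilon>}"
  define L where "L = {j. j \<in> J \<and> \<sigma> j \<le> \<epsilon>}"
  define c where "c j = cnj (v j 0) * of_real (\<sigma> j)" for j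
  \<comment> \<open>The part of the expansion of \<open>1\<close> that the truncation discards.\<close>
  define w where "w t = (\<Sum>j\<in>L. c j * u j t)" for t
  have fin: "finite J" "finite H" "finite L" and JHL: "J = H \<union> L" "H \<inter> L = {}" "L \<subseteq> J"
    by (auto simp: J_def H_def L_def)
  have u: "u j \<in> L2 (Lam T)" if "j \<in> L" for j
    using assms(1) that by (simp add: singular_system_def L_def J_def)
  have w: "w \<in> L2 (Lam T)"
    unfolding w_def[abs_def] by (intro L2_sum L2_cmult u)
  have inner_w: "L2_inner (Lam T) h w = (\<Sum>j\<in>L. cnj (c j) * L2_inner (Lam T) h (u j))"
    if "h \<in> L2 (Lam T)" for h
    unfolding w_def[abs_def] by (intro L2_inner_sum_right that u)
  have diff: "integral\<^sup>L (lebesgue_on (Lam T)) g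
      - integral\<^sup>L (lebesgue_on (Lam T)) (tsvd_approx T N \<sigma> v u \<epsilon> g) = L2_inner (Lam T) g w"
    unfolding integral_Lam_expansion[OF assms(1,2)] integral_tsvd_approx[OF assms(1,2)]
      inner_w[OF assms(2)] J_def[symmetric] H_def[symmetric]
    using fin JHL by (simp add: sum.union_disjoint c_def)
  have "L2_inner (Lam T) w w = integral\<^sup>L (lebesgue_on (Lam T)) (\<lambda>t. \<Sum>j\<in>L. c j * (u j t * cnj (w t)))"
    by (simp add: L2_inner_def w_def sum_distrib_right mult.assoc)
  also have "\<dots> = (\<Sum>j\<in>L. c j * L2_inner (Lam T) (u j) w)"
    using L2_mult_cnj_integrable[OF u w] by (simp add: L2_inner_def)
  also have "\<dots> = (\<Sum>j\<in>L. c j * (\<Sum>i\<in>L. if j = i then cnj (c i) else 0))"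
  proof (intro sum.cong refl arg_cong2[of _ _ _ _ "(*)"])
    fix j assume j: "j \<in> L"
    have "L2_inner (Lam T) (u j) w = (\<Sum>i\<in>L. cnj (c i) * L2_inner (Lam T) (u j) (u i))"
      by (rule inner_w[OF u[OF j]])
    also have "\<dots> = (\<Sum>i\<in>L. if j = i then cnj (c i) else 0)"
      using assms(1) j
      by (intro sum.cong refl) (auto simp: singular_system_def L_def J_def)
    finally show "L2_inner (Lam T) (u j) w = (\<Sum>i\<in>L. if j = i then cnj (c i) else 0)" .
  qed
  also have "\<dots> = of_real (\<Sum>j\<in>L. (cmod (c j))\<^sup>2)"
    using fin by (simp flip: complex_norm_square)
  finally have ww: "integral\<^sup>L (lebesgue_on (Lam T)) (\<lambda>t. (cmod (w t))\<^sup>2) = (\<Sum>j\<in>L. (cmod (c j))\<^sup>2)"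
    unfolding L2_inner_self by (simp only: of_real_eq_iff)
  also have "\<dots> \<le> (\<Sum>j\<in>L. \<epsilon>\<^sup>2 * (cmod (v j 0))\<^sup>2)"
  proof (rule sum_mono)
    fix j assume "j \<in> L"
    then have "0 \<le> \<sigma> j" "\<sigma> j \<le> \<epsilon>"
      using assms(1) by (auto simp: singular_system_def L_def J_def less_imp_le)
    then have "(\<sigma> j)\<^sup>2 \<le> \<epsilon>\<^sup>2"
      by (intro power_mono)
    then show "(cmod (c j))\<^sup>2 \<le> \<epsilon>\<^sup>2 * (cmod (v j 0))\<^sup>2"
      by (simp add: c_def norm_mult power_mult_distrib mult.commute[of "(cmod (v j 0))\<^sup>2"] mult_right_mono)
  qed
  also have "\<dots> \<le> (\<Sum>j\<in>J. \<epsilon>\<^sup>2 * (cmod (v j 0))\<^sup>2)"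
    using fin JHL by (intro sum_mono2) auto
  also have "\<dots> = \<epsilon>\<^sup>2"
  proof -
    have "complex_of_real (\<Sum>j\<in>J. (cmod (v j 0))\<^sup>2) = (\<Sum>j\<in>J. cnj (v j 0) * v j 0)"
      by (simp add: mult.commute[of "cnj _"] flip: complex_norm_square)
    also have "\<dots> = 1"
      using orthonormal_complete[of N v 0 0] assms(1)
      by (simp add: J_def singular_system_def freqs_def)
    finally have "(\<Sum>j\<in>J. (cmod (v j 0))\<^sup>2) = 1"
      by (simp only: of_real_eq_1_iff)
    then show ?thesis
      by (simp flip: sum_distrib_left)
  qed
  finally have w_le: "integral\<^sup>L (lebesgue_on (Lam T)) (\<lambda>t. (cmod (w t))\<^sup>2) \<le> \<epsilon>\<^sup>2" .
  have "cmod (L2_inner (Lam T) g w)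
      \<le> \<epsilon> / 2 * integral\<^sup>L (lebesgue_on (Lam T)) (\<lambda>t. (cmod (g t))\<^sup>2)
        + integral\<^sup>L (lebesgue_on (Lam T)) (\<lambda>t. (cmod (w t))\<^sup>2) / (2 * \<epsilon>)"
    by (rule L2_inner_Young[OF assms(2) w assms(3)])
  also have "\<dots> \<le> \<epsilon> / 2 * integral\<^sup>L (lebesgue_on (Lam T)) (\<lambda>t. (cmod (g t))\<^sup>2) + \<epsilon>\<^sup>2 / (2 * \<epsilon>)"
    using w_le assms(3) by (intro add_mono divide_right_mono) auto
  also have "\<dots> = \<epsilon> / 2 * (integral\<^sup>L (lebesgue_on (Lam T)) (\<lambda>t. (cmod (g t))\<^sup>2) + 1)"
    using assms(3) by (simp add: power2_eq_square field_simps)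
  finally show ?thesis
    by (simp add: diff)
qed

section \<open>The composite quadrature\<close>

text \<open>
  The left endpoint of the subinterval is excluded: for \<open>k > 0\<close> the value there is taken from the
  preceding subinterval. Subintervals are counted from \<open>1\<close>, hence the index \<open>Suc k\<close>.
\<close>

lemma local_ext_on_subint:
  assumes "is_partition a b K x" "k < K" "x k < y" "y \<le> x (Suc k)"
  shows "local_ext T N \<sigma> v u \<epsilon> K x f y =
    tsvd_approx T N \<sigma> v u \<epsilon> (local_fun T x f (Suc k)) ((y - x k) / seg_scale T x (Suc k))"
proof -
  have step: "x k \<le> x (Suc k)" if "k < K" for k
    using assms(1) that by (simp add: is_partition_def less_imp_le)
  have "(LEAST k. k \<in> {1..K} \<and> y \<in> subint x k) = Suc k"
  proof (rule Least_equality)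
    show "Suc k \<in> {1..K} \<and> y \<in> subint x (Suc k)"
      using assms by (simp add: subint_def)
    fix j assume j: "j \<in> {1..K} \<and> y \<in> subint x j"
    show "Suc k \<le> j"
    proof (rule ccontr)
      assume "\<not> Suc k \<le> j"
      then have "x j \<le> x k"
        using assms(2) chain_mono[of K x j k, OF step] by simp
      with j assms(3) show False
        by (simp add: subint_def)
    qed
  qed
  then show ?thesis
    by (simp add: local_ext_def Let_def)
qed

lemma quadrature_error:
  assumes "T > 0" "f \<in> L2 {a..b}" "is_partition a b K x" "\<epsilon> > 0"
    "singular_system T N \<sigma> v u"
  shows "cmod (integral\<^sup>L (lebesgue_on {a..b}) f - local_quad T N \<sigma> v u \<epsilon> a b K x f)
    \<le> \<epsilon> / 2 * (integral\<^sup>L (lebesgue_on {a..b}) (\<lambda>y. (cmod (f y))\<^sup>2) + T / (2 * pi) * (b - a))"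
proof -
  define s where "s k = seg_scale T x (Suc k)" for k
  define g where "g k = local_fun T x f (Suc k)" for k
  define I where "I h = integral\<^sup>L (lebesgue_on (Lam T)) h" for h :: "real \<Rightarrow> complex"
  define G where "G k = integral\<^sup>L (lebesgue_on (Lam T)) (\<lambda>t. (cmod (g k t))\<^sup>2)" for k
  define Q where "Q k = tsvd_approx T N \<sigma> v u \<epsilon> (g k)" for k
  have x0: "x 0 = a" and xK: "x K = b" and xlt: "\<And>k. k < K \<Longrightarrow> x k < x (Suc k)"
    using assms(3) by (auto simp: is_partition_def)
  have s_pos: "s k > 0" if "k < K" for k
    using xlt[OF that] assms(1) by (simp add: s_def seg_scale_def)
  have sub: "{x k + s k * 0..x k + s k * (2 * pi / T)} = {x k..x (Suc k)}" for k
    using assms(1) by (simp add: s_def seg_scale_def)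
  have g_eq: "g k = (\<lambda>t. f (x k + s k * t))" for k
    by (simp add: g_def local_fun_def s_def fun_eq_iff)
  have bounds: "a \<le> x k \<and> x k \<le> b" if "k \<le> K" for k
    using chain_mono[of K x 0 k] chain_mono[of K x k K] xlt that
    by (simp add: x0 xK less_imp_le)
  have f_L2: "f \<in> L2 {x k..x (Suc k)}" if "k < K" for k
    using assms(2) bounds[of k] bounds[of "Suc k"] that by (intro L2_subset[OF assms(2)]) auto
  have g_L2: "g k \<in> L2 (Lam T)" if "k < K" for k
    unfolding g_eq Lam_def
    by (rule L2_affine[OF _ s_pos[OF that]]) (use f_L2[OF that] in \<open>simp only: sub\<close>)
  have scale: "has_bochner_integral (lebesgue_on {x k..x (Suc k)}) h (s k *\<^sub>R i)"
    if "k < K" "has_bochner_integral (lebesgue_on (Lam T)) (\<lambda>t. h (x k + s k * t)) i"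
    for k i and h :: "real \<Rightarrow> 'b::euclidean_space"
    using has_bochner_integral_affine_interval[OF s_pos[OF that(1)], of "x k" 0 "2 * pi / T" h i] that(2)
    unfolding sub by (simp add: Lam_def)
  have part: "has_bochner_integral (lebesgue_on {a..b}) h (\<Sum>k<K. s k *\<^sub>R i k)"
    if "\<And>k. k < K \<Longrightarrow> has_bochner_integral (lebesgue_on {x k..x (Suc k)}) h (s k *\<^sub>R i k)"
    for h :: "real \<Rightarrow> 'b::euclidean_space" and i
    using has_bochner_integral_partition[of K x h "\<lambda>k. s k *\<^sub>R i k"] that xlt
    by (simp add: x0 xK less_imp_le)
  have "has_bochner_integral (lebesgue_on {a..b}) f (\<Sum>k<K. s k *\<^sub>R I (g k))"
  proof (intro part scale)
    fix k assume "k < K"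
    then show "has_bochner_integral (lebesgue_on (Lam T)) (\<lambda>t. f (x k + s k * t)) (I (g k))"
      using L2_imp_integrable[OF g_L2[OF \<open>k < K\<close>, unfolded Lam_def]]
      by (simp add: has_bochner_integral_iff I_def Lam_def g_eq)
  qed
  then have int_f: "integral\<^sup>L (lebesgue_on {a..b}) f = (\<Sum>k<K. s k *\<^sub>R I (g k))"
    by (simp add: has_bochner_integral_iff)
  have "has_bochner_integral (lebesgue_on {a..b}) (\<lambda>y. (cmod (f y))\<^sup>2) (\<Sum>k<K. s k *\<^sub>R G k)"
  proof (intro part scale)
    fix k assume "k < K"
    then show "has_bochner_integral (lebesgue_on (Lam T)) (\<lambda>t. (cmod (f (x k + s k * t)))\<^sup>2) (G k)"
      using g_L2[OF \<open>k < K\<close>]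
      by (simp add: has_bochner_integral_iff G_def L2_def g_eq)
  qed
  then have int_f2: "integral\<^sup>L (lebesgue_on {a..b}) (\<lambda>y. (cmod (f y))\<^sup>2) = (\<Sum>k<K. s k * G k)"
    by (simp add: has_bochner_integral_iff)
  have "has_bochner_integral (lebesgue_on {a..b}) (local_ext T N \<sigma> v u \<epsilon> K x f)
      (\<Sum>k<K. s k *\<^sub>R I (Q k))"
  proof (rule part, rule scale)
    fix k assume k: "k < K"
    have "has_bochner_integral (lebesgue_on (Lam T)) (Q k) (I (Q k))"
      using continuous_imp_integrable_real[OF continuous_on_synth]
      by (simp add: has_bochner_integral_iff I_def Lam_def Q_def tsvd_approx_def)
    \<comment> \<open>At \<open>t = 0\<close> the value of \<open>local_ext\<close> may come from the preceding subinterval.\<close>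
    then show "has_bochner_integral (lebesgue_on (Lam T))
        (\<lambda>t. local_ext T N \<sigma> v u \<epsilon> K x f (x k + s k * t)) (I (Q k))"
    proof (rule has_bochner_integral_spike_finite[where F = "{0}"])
      fix t assume t: "t \<in> Lam T - {0}"
      then have "x k + s k * t \<in> {x k + s k * 0..x k + s k * (2 * pi / T)}"
        using s_pos[OF k] unfolding Lam_def atLeastAtMost_iff
        by (intro conjI add_left_mono mult_left_mono) auto
      then have "x k + s k * t \<le> x (Suc k)"
        unfolding sub by simp
      moreover have "x k < x k + s k * t"
        using t s_pos[OF k] by (simp add: Lam_def)
      ultimately show "Q k t = local_ext T N \<sigma> v u \<epsilon> K x f (x k + s k * t)"
        using s_pos[OF k]
        by (simp add: local_ext_on_subint[OF assms(3) k] Q_def g_def flip: s_def)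
    qed (auto simp: Lam_def)
  qed assumption
  then have quad: "local_quad T N \<sigma> v u \<epsilon> a b K x f = (\<Sum>k<K. s k *\<^sub>R I (Q k))"
    by (simp add: has_bochner_integral_iff local_quad_def)
  have sum_s: "(\<Sum>k<K. s k) = T / (2 * pi) * (b - a)"
    unfolding s_def seg_scale_def sum_distrib_left[symmetric]
    using sum_lessThan_telescope[of x K] by (simp add: x0 xK)
  have "cmod (integral\<^sup>L (lebesgue_on {a..b}) f - local_quad T N \<sigma> v u \<epsilon> a b K x f)
      = cmod (\<Sum>k<K. s k *\<^sub>R (I (g k) - I (Q k)))"
    by (simp add: int_f quad scaleR_diff_right sum_subtractf)
  also have "\<dots> \<le> (\<Sum>k<K. s k * cmod (I (g k) - I (Q k)))"
    by (rule order_trans[OF norm_sum]) (use s_pos in \<open>simp add: less_imp_le\<close>)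
  also have "\<dots> \<le> (\<Sum>k<K. s k * (\<epsilon> / 2 * (G k + 1)))"
    unfolding I_def Q_def G_def
    by (intro sum_mono mult_left_mono tsvd_integral_error assms g_L2)
       (use s_pos in \<open>auto simp: less_imp_le\<close>)
  also have "\<dots> = \<epsilon> / 2 * ((\<Sum>k<K. s k * G k) + (\<Sum>k<K. s k))"
    unfolding sum.distrib[symmetric] sum_distrib_left
    by (intro sum.cong refl) (simp add: algebra_simps)
  finally show ?thesis
    unfolding int_f2 sum_s .
qed

theorem theorem2p3:
  fixes a b T :: real and p :: nat and f :: "real \<Rightarrow> complex"
  assumes "a < b" and "T > 1" and "p \<ge> 1" and "f \<in> sobolev p a b"
  shows "\<exists>C C' :: real. C > 0 \<and> C' > 0 \<and>
    (\<forall>(N :: nat) (K :: nat) (x :: nat \<Rightarrow> real) (\<epsilon> :: real)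
      (\<sigma> :: nat \<Rightarrow> real) (v :: nat \<Rightarrow> int \<Rightarrow> complex) (u :: nat \<Rightarrow> real \<Rightarrow> complex).
      N \<ge> 1 \<longrightarrow> K \<ge> 1 \<longrightarrow> is_partition a b K x \<longrightarrow> \<epsilon> > 0 \<longrightarrow> singular_system T N \<sigma> v u \<longrightarrow>
      cmod (integral\<^sup>L (lebesgue_on {a..b}) f - local_quad T N \<sigma> v u \<epsilon> a b K x f)
        \<le> C * (b - a) * real N powr (- real p) *
            Max ((\<lambda>k. seg_scale T x k powr (real p - 1 / 2) *
                       L2_norm (subint x k) (weak_deriv p a b f)) ` {1..K})
          + C' * \<epsilon>)"
proof -
  define C' where "C' = 1 / 2 *
    (integral\<^sup>L (lebesgue_on {a..b}) (\<lambda>y. (cmod (f y))\<^sup>2) + T / (2 * pi) * (b - a))"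
  have f: "f \<in> L2 {a..b}"
    using assms(4) by (auto simp: sobolev_def intro: L2_closed_interval)
  have "0 < T / (2 * pi) * (b - a)"
    using assms by simp
  moreover have "0 \<le> integral\<^sup>L (lebesgue_on {a..b}) (\<lambda>y. (cmod (f y))\<^sup>2)"
    by simp
  ultimately have "C' > 0"
    unfolding C'_def by (intro mult_pos_pos[of "1 / 2"] add_nonneg_pos) simp_all
  have bound: "cmod (integral\<^sup>L (lebesgue_on {a..b}) f - local_quad T N \<sigma> v u \<epsilon> a b K x f)
        \<le> 1 * (b - a) * real N powr (- real p) *
            Max ((\<lambda>k. seg_scale T x k powr (real p - 1 / 2) *
                       L2_norm (subint x k) (weak_deriv p a b f)) ` {1..K})
          + C' * \<epsilon>"
    if "K \<ge> 1" "is_partition a b K x" "\<epsilon> > 0" "singular_system T N \<sigma> v u"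
    for N K x \<epsilon> \<sigma> v u
  proof -
    let ?F = "\<lambda>k. seg_scale T x k powr (real p - 1 / 2) * L2_norm (subint x k) (weak_deriv p a b f)"
    have "0 \<le> ?F 1"
      by (simp add: L2_norm_def)
    also have "?F 1 \<le> Max (?F ` {1..K})"
      using that(1) by (intro Max_ge) auto
    finally have "0 \<le> 1 * (b - a) * real N powr (- real p) * Max (?F ` {1..K})"
      using assms(1) by simp
    moreover have "cmod (integral\<^sup>L (lebesgue_on {a..b}) f - local_quad T N \<sigma> v u \<epsilon> a b K x f)
        \<le> C' * \<epsilon>"
      using quadrature_error[OF _ f that(2-4)] assms(2) by (simp add: C'_def mult_ac)
    ultimately show ?thesis
      by linarith
  qed
  show ?thesis
  proof (rule exI[of _ 1], rule exI[of _ C'], intro conjI allI impI)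
    show "(0::real) < 1" by simp
    show "C' > 0" by fact
  qed (rule bound)
qed

end
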